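(* For $n\ge2$, the number of $n\times n$ diagonally symmetric alternating sign matrices can be expressed as a weighted sum over all $(n-1)\times(n-1)$ diagonally symmetric alternating sign matrices as $$|\mathrm{DSASM}(n)|=\sum_{A\in\mathrm{DSASM}(n-1)}2^{S(A)}.$$ Furthermore, this can be generalized to the generating function identity $$X_n(r,1,t)=t\,X_{n-1}(r,r+1,t)+t(1-t)\,X_{n-1}(r,1,1),$$ or equivalently $$X_n(r,1,t)=t\,X_{n-1}(r,r+1,t)+t(1-t)\,X_{n-2}(r,r+1,1),$$ for $n\ge3$.
   Context: An alternating sign matrix (ASM) is a square matrix with entries in $\{0,1,-1\}$ such that along each row and each column the nonzero entries alternate in sign and have sum $1$. A diagonally symmetric ASM (DSASM) is an ASM which equals its transpose. $\mathrm{DSASM}(n)$ is the set of $n\times n$ DSASMs. For $A\in\mathrm{DSASM}(n)$ let $R(A)=\sum_{1\le i<j\le n}|A_{ij}|$, $S(A)=\sum_{i=1}^n|A_{ii}|$ (number of nonzero diagonal entries), and $T(A)=$ the column number of the unique $1$ in the first row of $A$. For indeterminates $r,s,t$, $X_n(r,s,t)=\sum_{A\in\mathrm{DSASM}(n)}r^{R(A)}s^{S(A)}t^{T(A)}$. *)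

theory Defs
  imports "Jordan_Normal_Form.Matrix"
begin

definition alternating_vec :: "int vec \<Rightarrow> bool" where
  "alternating_vec v \<longleftrightarrow>
     (\<forall>i j. i < j \<and> j < dim_vec v \<and> v $ i \<noteq> 0 \<and> v $ j \<noteq> 0 \<and>
        (\<forall>k. i < k \<and> k < j \<longrightarrow> v $ k = 0) \<longrightarrow> sgn (v $ j) = - sgn (v $ i))"

definition ASM :: "nat \<Rightarrow> int mat set" where
  "ASM n = {A \<in> carrier_mat n n.
     (\<forall>i<n. \<forall>j<n. A $$ (i, j) \<in> {0, 1, -1}) \<and>
     (\<forall>i<n. alternating_vec (row A i) \<and> (\<Sum>j<n. A $$ (i, j)) = 1) \<and>
     (\<forall>j<n. alternating_vec (col A j) \<and> (\<Sum>i<n. A $$ (i, j)) = 1)}"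

definition DSASM :: "nat \<Rightarrow> int mat set" where
  "DSASM n = {A \<in> ASM n. transpose_mat A = A}"

definition R_stat :: "int mat \<Rightarrow> nat" where
  "R_stat A = nat (\<Sum>j<dim_row A. \<Sum>i<j. \<bar>A $$ (i, j)\<bar>)"

definition S_stat :: "int mat \<Rightarrow> nat" where
  "S_stat A = nat (\<Sum>i<dim_row A. \<bar>A $$ (i, i)\<bar>)"

(* Matrix indices start at 0 in the library, whereas column numbers start at 1;
   the value is meaningful only for n x n ASMs with n \<ge> 1. *)
definition T_stat :: "int mat \<Rightarrow> nat" where
  "T_stat A = Suc (THE j. j < dim_col A \<and> A $$ (0, j) = 1)"

(* Evaluating at arbitrary elements of an arbitrary commutative ring covers
   indeterminates: take r, s, t to be the variables of a polynomial ring. *)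
definition X_gf :: "nat \<Rightarrow> 'a::comm_ring_1 \<Rightarrow> 'a \<Rightarrow> 'a \<Rightarrow> 'a" where
  "X_gf n r s t = (\<Sum>A\<in>DSASM n. r ^ R_stat A * s ^ S_stat A * t ^ T_stat A)"

end

theory Submission imports Defs begin

text \<open>
A diagonally symmetric ASM is determined by its strict upper triangle, and the triangles that
occur have a simple description: reading a column downwards from the top, or a row leftwards
from the right end, the partial sums must stay in \<open>{0, 1}\<close>. The diagonal imposes no further
condition. If \<open>c\<close> is the sum of the triangle entries above the diagonal position \<open>i\<close> and \<open>d\<close>
the sum of those to its right, then \<open>A\<^sub>i\<^sub>i = 1 - c - d\<close>, which is \<open>1\<close> if \<open>c = d = 0\<close>,
\<open>-1\<close> if \<open>c = d = 1\<close> and \<open>0\<close> otherwise (\<open>bij_betw_sym_mat\<close>).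

Now shift the strict upper triangle of a matrix of size \<open>m + 1\<close> one column to the left. It
becomes an upper triangle of size \<open>m\<close> including the diagonal, with the same conditions on
partial sums. Given its strict part, with sums \<open>c\<close> and \<open>d\<close> at position \<open>i\<close>, the entry at
\<open>(i, i)\<close> may be any \<open>a\<close> with \<open>c + a\<close> and \<open>d + a\<close> in \<open>{0, 1}\<close>: so \<open>a\<close> is \<open>0\<close> or
\<open>1 - c - d\<close>, where the latter is exactly the diagonal entry of the DSASM of size \<open>m\<close> with
this strict part. Hence the DSASMs of size \<open>m + 1\<close> correspond to the DSASMs \<open>B\<close> of size \<open>m\<close>
with a chosen subset \<open>U\<close> of the nonzero diagonal positions (\<open>bij_betw_insert_diag\<close>), and \<open>R\<close>
grows by \<open>card U\<close>. Summing over \<open>U\<close> turns the weight \<open>1\<close> into \<open>(r + 1)\<close> to the power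
\<open>S(B)\<close>. This proves the cardinality formula, at \<open>r = 1\<close>, and the recurrence at \<open>t = 1\<close>.

For general \<open>t\<close>, the shift increases \<open>T\<close> by one, with a single exception: if \<open>T(B) = 1\<close> and
the corner is not in \<open>U\<close>, then the new matrix again has its leading \<open>1\<close> in the corner. For
these \<open>B\<close> the choice at the corner contributes \<open>t + r t\<^sup>2\<close> instead of \<open>(r + 1) t\<^sup>2\<close>, an excess of
\<open>t (1 - t)\<close> (\<open>superdiagonal_sum\<close>). Deleting the first row and column of these \<open>B\<close> gives all
DSASMs of size \<open>m - 1\<close> (\<open>bij_betw_prepend_row\<close>), so the correction term is
\<open>t (1 - t)\<close> times \<open>X\<close> at \<open>(m - 1; r, r + 1, 1)\<close>, which by the case \<open>t = 1\<close> is also \<open>X\<close> at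
\<open>(m; r, 1, 1)\<close>.
\<close>

section \<open>Alternation as a condition on partial sums\<close>

text \<open>
Nonzero entries of an interval cancel in consecutive pairs. For the induction on the right end
this is sharpened: the sum is \<open>0\<close> or the last nonzero entry of the interval, so that the
next nonzero entry, being its negative, either cancels it or becomes the sum.
\<close>

lemma alternating_interval_sum:
  fixes f :: "nat \<Rightarrow> int"
  assumes entries: "\<And>i. i < n \<Longrightarrow> f i \<in> {0, 1, -1}"
    and alt: "alternating_vec (vec n f)"
    and "j \<le> n"
  shows "\<bar>sum f {i..<j}\<bar> \<le> 1"
proof (cases "i \<le> j")
  case True
  have "((\<forall>k\<in>{i..<j}. f k = 0) \<and> sum f {i..<j} = 0) \<or>
      (\<exists>l\<in>{i..<j}. f l \<noteq> 0 \<and> (\<forall>k. l < k \<and> k < j \<longrightarrow> f k = 0) \<and> sum f {i..<j} \<in> {0, f l})"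
    using True \<open>j \<le> n\<close>
  proof (induction j rule: dec_induct)
    case base
    then show ?case by simp
  next
    case (step j)
    have sum: "sum f {i..<Suc j} = sum f {i..<j} + f j"
      using step.hyps by simp
    note IH = step.IH[OF Suc_leD[OF step.prems]]
    show ?case
    proof (cases "f j = 0")
      case True
      have eq: "sum f {i..<Suc j} = sum f {i..<j}" using sum True by simp
      from IH show ?thesis
      proof (elim disjE, goal_cases)
        case 1
        then have "f k = 0" if "k \<in> {i..<Suc j}" for k
          using True that by (cases "k = j") auto
        with 1 show ?case using eq by simp
      next
        case 2
        then obtain l where l: "i \<le> l" "l < j" "f l \<noteq> 0" "\<forall>k. l < k \<and> k < j \<longrightarrow> f k = 0"
            "sum f {i..<j} \<in> {0, f l}" by auto
        then have "f k = 0" if "l < k" "k < Suc j" for k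
          using True that by (cases "k = j") auto
        with l eq show ?case by (intro disjI2 bexI[of _ l]) auto
      qed
    next
      case False
      from IH have "sum f {i..<j} = 0 \<or> sum f {i..<j} = - f j"
      proof (elim disjE)
        assume "\<exists>l\<in>{i..<j}. f l \<noteq> 0 \<and> (\<forall>k. l < k \<and> k < j \<longrightarrow> f k = 0) \<and> sum f {i..<j} \<in> {0, f l}"
        then obtain l where l: "l < j" "f l \<noteq> 0" "\<forall>k. l < k \<and> k < j \<longrightarrow> f k = 0"
            "sum f {i..<j} \<in> {0, f l}" by auto
        have "sgn (f j) = - sgn (f l)"
          using alt l False step.prems unfolding alternating_vec_def by simp
        moreover have "f j \<in> {0,1,-1}" "f l \<in> {0,1,-1}"
          using entries[of j] entries[of l] step.prems l by auto
        ultimately have "f l = - f j" by auto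
        then show ?thesis using l by auto
      qed auto
      then have "sum f {i..<Suc j} \<in> {0, f j}" unfolding sum by auto
      with False step.hyps show ?thesis by (intro disjI2 bexI[of _ j]) auto
    qed
  qed
  then show ?thesis
  proof (elim disjE)
    assume "\<exists>l\<in>{i..<j}. f l \<noteq> 0 \<and> (\<forall>k. l < k \<and> k < j \<longrightarrow> f k = 0) \<and> sum f {i..<j} \<in> {0, f l}"
    then obtain l where "l < j" "sum f {i..<j} \<in> {0, f l}" by auto
    then show ?thesis using entries[of l] \<open>j \<le> n\<close> by auto
  qed auto
qed simp

text \<open>
Alternation bounds the sum before \<open>k\<close> and the sum from \<open>k\<close> on by \<open>1\<close> in absolute value; as
they add up to \<open>1\<close>, neither can be negative. Conversely, when a prefix sum moves within
\<open>{0, 1}\<close>, consecutive moves go in opposite directions.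
\<close>

lemma alternating_iff_prefix_sums:
  fixes f :: "nat \<Rightarrow> int"
  assumes total: "sum f {..<n} = 1"
  shows "(\<forall>i<n. f i \<in> {0, 1, -1}) \<and> alternating_vec (vec n f) \<longleftrightarrow>
    (\<forall>k\<le>n. sum f {..<k} \<in> {0, 1})"
proof (intro iffI allI impI, elim conjE)
  fix k
  assume entries: "\<forall>i<n. f i \<in> {0, 1, -1}" and alt: "alternating_vec (vec n f)" and k: "k \<le> n"
  have "sum f {..<k} + sum f {k..<n} = 1"
    using total sum.atLeastLessThan_concat[of 0 k n f] k by (simp add: lessThan_atLeast0)
  moreover have "\<bar>sum f {..<k}\<bar> \<le> 1" "\<bar>sum f {k..<n}\<bar> \<le> 1"
    using alternating_interval_sum[of n f k 0] alternating_interval_sum[of n f n k] entries alt k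
    by (auto simp: lessThan_atLeast0)
  ultimately show "sum f {..<k} \<in> {0, 1}" by auto
next
  assume pre: "\<forall>k\<le>n. sum f {..<k} \<in> {0, 1}"
  have step: "sum f {..<i} \<in> {0, 1}" "sum f {..<i} + f i \<in> {0, 1}" if "i < n" for i
    using pre[rule_format, of i] pre[rule_format, of "Suc i"] that by auto
  have "f i \<in> {0, 1, -1}" if "i < n" for i
    using step[OF that] by auto
  moreover have "sgn (f j) = - sgn (f i)"
    if ij: "i < j" "j < n" "f i \<noteq> 0" "f j \<noteq> 0" and zero: "\<forall>k. i < k \<and> k < j \<longrightarrow> f k = 0" for i j
  proof -
    have "sum f {..<j} = sum f {..<Suc i} + sum f {Suc i..<j}"
      using ij sum.atLeastLessThan_concat[of 0 "Suc i" j f] by (simp add: lessThan_atLeast0)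
    also have "sum f {Suc i..<j} = 0" using zero by (intro sum.neutral) auto
    finally have "sum f {..<j} = sum f {..<i} + f i" by simp
    then show ?thesis using step[of i] step[of j] ij by auto
  qed
  ultimately show "(\<forall>i<n. f i \<in> {0, 1, -1}) \<and> alternating_vec (vec n f)"
    unfolding alternating_vec_def by auto
qed

lemma DSASM_iff_prefix_sums:
  "A \<in> DSASM n \<longleftrightarrow> A \<in> carrier_mat n n \<and> transpose_mat A = A \<and>
     (\<forall>j<n. (\<Sum>i<n. A $$ (i, j)) = 1 \<and> (\<forall>k\<le>n. (\<Sum>i<k. A $$ (i, j)) \<in> {0, 1}))"
proof (cases "A \<in> carrier_mat n n \<and> transpose_mat A = A")
  case True
  then have A: "A \<in> carrier_mat n n" and t: "transpose_mat A = A" by auto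
  have sym: "A $$ (i, j) = A $$ (j, i)" if "i < n" "j < n" for i j
    using A that arg_cong[OF t, of "\<lambda>B. B $$ (i, j)"] by simp
  have col: "col A j = vec n (\<lambda>i. A $$ (i, j))" if "j < n" for j
    using A that by (intro eq_vecI) auto
  have row: "row A j = col A j" if "j < n" for j
    using A that sym by (intro eq_vecI) auto
  have rowsum: "(\<Sum>i<n. A $$ (j, i)) = (\<Sum>i<n. A $$ (i, j))" if "j < n" for j
    using sym that by (intro sum.cong) auto
  have entries: "(\<forall>i<n. \<forall>j<n. A $$ (i, j) \<in> {0, 1, -1}) \<longleftrightarrow>
      (\<forall>j<n. \<forall>i<n. A $$ (i, j) \<in> {0, 1, -1})" by blast
  have "A \<in> DSASM n \<longleftrightarrow> (\<forall>j<n. (\<Sum>i<n. A $$ (i, j)) = 1 \<and>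
      (\<forall>i<n. A $$ (i, j) \<in> {0, 1, -1}) \<and> alternating_vec (vec n (\<lambda>i. A $$ (i, j))))"
    unfolding DSASM_def ASM_def using A t row rowsum entries by (auto simp: col)
  then show ?thesis
    using A t alternating_iff_prefix_sums[of "\<lambda>i. A $$ (i, _)" n] by blast
qed (auto simp: DSASM_def ASM_def)

section \<open>The strict upper triangle of a diagonally symmetric ASM\<close>

text \<open>
Arrays are total functions that vanish outside the triangle \<open>i < j < n\<close>. Thus the bounds on the
partial sums need no range restrictions, sums over columns may extend past the diagonal, and
distinct functions represent distinct triangles.
\<close>

definition half_asm :: "nat \<Rightarrow> (nat \<Rightarrow> nat \<Rightarrow> int) set" where
  "half_asm n = {f. (\<forall>i j. \<not> (i < j \<and> j < n) \<longrightarrow> f i j = 0) \<and>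
     (\<forall>j k. (\<Sum>i<k. f i j) \<in> {0, 1}) \<and>
     (\<forall>i k. (\<Sum>j=k..<n. f i j) \<in> {0, 1})}"

text \<open>
The only value on the diagonal that gives row \<open>i\<close> of the symmetric matrix the sum \<open>1\<close>.
\<close>

definition forced_diag :: "nat \<Rightarrow> (nat \<Rightarrow> nat \<Rightarrow> int) \<Rightarrow> nat \<Rightarrow> int" where
  "forced_diag n f i = 1 - (\<Sum>k<i. f k i) - (\<Sum>k=Suc i..<n. f i k)"

definition sym_mat :: "nat \<Rightarrow> (nat \<Rightarrow> nat \<Rightarrow> int) \<Rightarrow> int mat" where
  "sym_mat n f = mat n n (\<lambda>(i, j). f i j + f j i + (if i = j then forced_diag n f i else 0))"

definition upper_part :: "nat \<Rightarrow> int mat \<Rightarrow> nat \<Rightarrow> nat \<Rightarrow> int" where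
  "upper_part n A i j = (if i < j \<and> j < n then A $$ (i, j) else 0)"

lemma half_asmD:
  assumes "f \<in> half_asm n"
  shows "\<not> (i < j \<and> j < n) \<Longrightarrow> f i j = 0"
    and "(\<Sum>i<k. f i j) \<in> {0, 1}"
    and "(\<Sum>j=k..<n. f i j) \<in> {0, 1}"
  using assms unfolding half_asm_def by auto

lemma half_asm_column_total:
  assumes "f \<in> half_asm n" "j \<le> k"
  shows "(\<Sum>i<k. f i j) = (\<Sum>i<j. f i j)"
  using assms half_asmD(1)[OF assms(1)] by (intro sum.mono_neutral_right) auto

lemma half_asm_row_total:
  assumes "f \<in> half_asm n" "k \<le> Suc i"
  shows "(\<Sum>j=k..<n. f i j) = (\<Sum>j=Suc i..<n. f i j)"
  using assms half_asmD(1)[OF assms(1)] by (intro sum.mono_neutral_right) auto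

lemma forced_diag_cases:
  assumes "f \<in> half_asm n"
  obtains "(\<Sum>k<i. f k i) = 0" "(\<Sum>k=Suc i..<n. f i k) = 0" "forced_diag n f i = 1"
    | "(\<Sum>k<i. f k i) = 1" "(\<Sum>k=Suc i..<n. f i k) = 1" "forced_diag n f i = -1"
    | "(\<Sum>k<i. f k i) \<noteq> (\<Sum>k=Suc i..<n. f i k)" "forced_diag n f i = 0"
  using half_asmD(2)[OF assms, of i i] half_asmD(3)[OF assms, of i "Suc i"]
  unfolding forced_diag_def by fastforce

text \<open>
In column \<open>j\<close>, a prefix ending above the diagonal is a column prefix of the triangle; by symmetry
and by the choice of the diagonal entry, a longer prefix is \<open>1\<close> minus a row suffix of the triangle.
\<close>

lemma sym_mat_in_DSASM:
  assumes f: "f \<in> half_asm n"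
  shows "sym_mat n f \<in> DSASM n"
proof -
  have prefix: "(\<Sum>i<k. sym_mat n f $$ (i, j)) =
      (if k \<le> j then \<Sum>i<k. f i j else 1 - (\<Sum>i=k..<n. f j i))"
    if "j < n" "k \<le> n" for j k
  proof -
    have "(\<Sum>i<k. sym_mat n f $$ (i, j)) =
        (\<Sum>i<k. f i j + f j i + (if i = j then forced_diag n f j else 0))"
      using that by (intro sum.cong) (auto simp: sym_mat_def)
    also have "\<dots> = (\<Sum>i<k. f i j) + (\<Sum>i<k. f j i) + (if j < k then forced_diag n f j else 0)"
      by (simp add: sum.distrib)
    also have "\<dots> = (if k \<le> j then \<Sum>i<k. f i j else 1 - (\<Sum>i=k..<n. f j i))"
    proof (cases "k \<le> j")
      case True
      then have "(\<Sum>i<k. f j i) = 0"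
        using half_asmD(1)[OF f] by (intro sum.neutral) auto
      then show ?thesis using True by simp
    next
      case False
      have "(\<Sum>i<k. f j i) + (\<Sum>i=k..<n. f j i) = (\<Sum>i=0..<n. f j i)"
        using that sum.atLeastLessThan_concat[of 0 k n "f j"] by (simp add: lessThan_atLeast0)
      then show ?thesis
        using False half_asm_column_total[OF f, of j k] half_asm_row_total[OF f, of 0 j]
        by (simp add: forced_diag_def)
    qed
    finally show ?thesis .
  qed
  show ?thesis unfolding DSASM_iff_prefix_sums
  proof (intro conjI allI impI)
    show "sym_mat n f \<in> carrier_mat n n" by (simp add: sym_mat_def)
    show "transpose_mat (sym_mat n f) = sym_mat n f"
      by (intro eq_matI) (auto simp: sym_mat_def)
    fix j assume "j < n"
    then show "(\<Sum>i<n. sym_mat n f $$ (i, j)) = 1" by (simp add: prefix)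
    fix k assume "k \<le> n"
    show "(\<Sum>i<k. sym_mat n f $$ (i, j)) \<in> {0, 1}"
      unfolding prefix[OF \<open>j < n\<close> \<open>k \<le> n\<close>]
      using half_asmD(2)[OF f, of j k] half_asmD(3)[OF f, of j k] by auto
  qed
qed

lemma upper_part_in_half_asm:
  assumes "A \<in> DSASM n"
  shows "upper_part n A \<in> half_asm n" "sym_mat n (upper_part n A) = A"
proof -
  have A: "A \<in> carrier_mat n n" and t: "transpose_mat A = A"
    and total: "\<And>j. j < n \<Longrightarrow> (\<Sum>i<n. A $$ (i, j)) = 1"
    and prefix: "\<And>j k. j < n \<Longrightarrow> k \<le> n \<Longrightarrow> (\<Sum>i<k. A $$ (i, j)) \<in> {0, 1}"
    using assms unfolding DSASM_iff_prefix_sums by auto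
  have sym: "A $$ (i, j) = A $$ (j, i)" if "i < n" "j < n" for i j
    using A that arg_cong[OF t, of "\<lambda>B. B $$ (i, j)"] by simp
  have col: "(\<Sum>i<k. upper_part n A i j) = (\<Sum>i<min k j. A $$ (i, j))" if "j < n" for j k
  proof -
    have "(\<Sum>i<k. upper_part n A i j) = (\<Sum>i<min k j. upper_part n A i j)"
      by (intro sum.mono_neutral_right) (auto simp: upper_part_def)
    then show ?thesis using that by (simp add: upper_part_def)
  qed
  have row: "(\<Sum>j=k..<n. upper_part n A i j) = 1 - (\<Sum>j<max k (Suc i). A $$ (j, i))"
    if "i < n" "k \<le> n" for i k
  proof -
    let ?m = "max k (Suc i)"
    have "(\<Sum>j=k..<n. upper_part n A i j) = (\<Sum>j=?m..<n. upper_part n A i j)"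
      by (intro sum.mono_neutral_right) (auto simp: upper_part_def)
    also have "\<dots> = (\<Sum>j=?m..<n. A $$ (j, i))"
      using that sym by (intro sum.cong) (auto simp: upper_part_def)
    also have "\<dots> = 1 - (\<Sum>j<?m. A $$ (j, i))"
      using total[of i] that sum.atLeastLessThan_concat[of 0 ?m n "\<lambda>j. A $$ (j, i)"]
      by (simp add: lessThan_atLeast0)
    finally show ?thesis .
  qed
  show "upper_part n A \<in> half_asm n"
    unfolding half_asm_def mem_Collect_eq
  proof (intro conjI allI impI)
    fix i j k
    show "upper_part n A i j = 0" if "\<not> (i < j \<and> j < n)"
      using that by (auto simp: upper_part_def)
    show "(\<Sum>i<k. upper_part n A i j) \<in> {0, 1}"
    proof (cases "j < n")
      case True
      then show ?thesis unfolding col[OF True] by (intro prefix) auto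
    qed (simp add: upper_part_def)
    show "(\<Sum>j=k..<n. upper_part n A i j) \<in> {0, 1}"
    proof (cases "i < n \<and> k \<le> n")
      case True
      then show ?thesis
        using row[of i k] prefix[of i "max k (Suc i)"] by auto
    next
      case False
      then have "(\<Sum>j=k..<n. upper_part n A i j) = 0"
        by (intro sum.neutral) (auto simp: upper_part_def)
      then show ?thesis by simp
    qed
  qed
  have "forced_diag n (upper_part n A) i = A $$ (i, i)" if "i < n" for i
    using that unfolding forced_diag_def by (simp add: col row)
  then show "sym_mat n (upper_part n A) = A"
    using A sym by (intro eq_matI) (auto simp: sym_mat_def upper_part_def)
qed

lemma bij_betw_sym_mat: "bij_betw (sym_mat n) (half_asm n) (DSASM n)"
proof (intro bij_betw_byWitness[where f' = "upper_part n"] ballI)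
  fix f assume f: "f \<in> half_asm n"
  then show "upper_part n (sym_mat n f) = f"
    by (intro ext) (auto simp: upper_part_def sym_mat_def half_asmD(1))
qed (auto simp: sym_mat_in_DSASM upper_part_in_half_asm)

section \<open>Statistics in terms of the upper triangle\<close>

definition half_weight :: "nat \<Rightarrow> (nat \<Rightarrow> nat \<Rightarrow> int) \<Rightarrow> nat" where
  "half_weight n f = nat (\<Sum>j<n. \<Sum>i<j. \<bar>f i j\<bar>)"

definition diag_support :: "nat \<Rightarrow> (nat \<Rightarrow> nat \<Rightarrow> int) \<Rightarrow> nat set" where
  "diag_support n f = {i. i < n \<and> forced_diag n f i \<noteq> 0}"

lemma finite_diag_support [simp]: "finite (diag_support n f)"
  by (simp add: diag_support_def)

lemma R_stat_sym_mat:
  assumes "f \<in> half_asm n"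
  shows "R_stat (sym_mat n f) = half_weight n f"
proof -
  have "(\<Sum>j<n. \<Sum>i<j. \<bar>sym_mat n f $$ (i, j)\<bar>) = (\<Sum>j<n. \<Sum>i<j. \<bar>f i j\<bar>)"
    using half_asmD(1)[OF assms] by (intro sum.cong refl) (simp add: sym_mat_def)
  then show ?thesis by (simp add: R_stat_def half_weight_def) (simp add: sym_mat_def)
qed

lemma S_stat_sym_mat:
  assumes f: "f \<in> half_asm n"
  shows "S_stat (sym_mat n f) = card (diag_support n f)"
proof -
  have "(\<Sum>i<n. \<bar>sym_mat n f $$ (i, i)\<bar>) = (\<Sum>i<n. if forced_diag n f i \<noteq> 0 then 1 else 0)"
  proof (intro sum.cong refl)
    fix i assume "i \<in> {..<n}"
    then show "\<bar>sym_mat n f $$ (i, i)\<bar> = (if forced_diag n f i \<noteq> 0 then 1 else 0)"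
      using half_asmD(1)[OF f, of i i] by (cases rule: forced_diag_cases[OF f, of i]) (auto simp: sym_mat_def)
  qed
  also have "\<dots> = int (card (diag_support n f))"
    by (simp add: sum.If_cases diag_support_def lessThan_def Int_def)
  finally show ?thesis by (simp add: S_stat_def) (simp add: sym_mat_def)
qed

text \<open>
The first row has no negative entry, since its entries are prefix sums of length one of the
columns. So the description in \<open>T_stat\<close> denotes.
\<close>

lemma DSASM_first_row:
  assumes "A \<in> DSASM n" "n > 0"
  shows "\<exists>!j. j < n \<and> A $$ (0, j) = 1"
proof -
  have A: "A \<in> carrier_mat n n" and t: "transpose_mat A = A"
    and total: "(\<Sum>i<n. A $$ (i, 0)) = 1"
    and prefix: "\<And>j k. j < n \<Longrightarrow> k \<le> n \<Longrightarrow> (\<Sum>i<k. A $$ (i, j)) \<in> {0, 1}"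
    using assms unfolding DSASM_iff_prefix_sums by auto
  have sym: "A $$ (i, 0) = A $$ (0, i)" if "i < n" for i
    using A that \<open>n > 0\<close> arg_cong[OF t, of "\<lambda>B. B $$ (i, 0)"] by simp
  have entry: "A $$ (0, j) = (if A $$ (0, j) = 1 then 1 else 0)" if "j < n" for j
    using prefix[of j 1] that by auto
  have "(\<Sum>j<n. A $$ (0, j)) = (\<Sum>j<n. if A $$ (0, j) = 1 then 1 else 0)"
    using entry by (intro sum.cong) auto
  also have "\<dots> = int (card {j. j < n \<and> A $$ (0, j) = 1})"
    by (simp add: sum.If_cases lessThan_def Int_def)
  finally have "card {j. j < n \<and> A $$ (0, j) = 1} = 1"
    using total sym by simp
  then obtain j where "{j. j < n \<and> A $$ (0, j) = 1} = {j}"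
    by (rule card_1_singletonE)
  then have "i < n \<and> A $$ (0, i) = 1 \<longleftrightarrow> i = j" for i
    by (simp add: set_eq_iff)
  then show ?thesis by simp
qed

lemma T_stat_eqI:
  assumes "A \<in> DSASM n" "j < n" "A $$ (0, j) = 1"
  shows "T_stat A = Suc j"
proof -
  have "dim_col A = n" using assms(1) by (auto simp: DSASM_iff_prefix_sums)
  then show ?thesis
    unfolding T_stat_def using DSASM_first_row[OF assms(1)] assms(2,3)
    by (auto intro!: the1_equality)
qed

section \<open>Inserting a new superdiagonal\<close>

text \<open>
The columns of \<open>f\<close> move one step to the right. This frees the positions \<open>(i, i + 1)\<close>, where the
entries indexed by \<open>U\<close> are switched on with the sign of the diagonal entry of \<open>sym_mat m f\<close>.
\<close>

definition insert_diag :: "nat \<Rightarrow> (nat \<Rightarrow> nat \<Rightarrow> int) \<Rightarrow> nat set \<Rightarrow> nat \<Rightarrow> nat \<Rightarrow> int" where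
  "insert_diag m f U i j = (case j of 0 \<Rightarrow> 0
     | Suc k \<Rightarrow> f i k + (if i = k \<and> i \<in> U then forced_diag m f i else 0))"

definition delete_diag :: "(nat \<Rightarrow> nat \<Rightarrow> int) \<Rightarrow> nat \<Rightarrow> nat \<Rightarrow> int" where
  "delete_diag g i k = (if i < k then g i (Suc k) else 0)"

lemma insert_diag_simps [simp]:
  "insert_diag m f U i 0 = 0"
  "insert_diag m f U i (Suc k) = f i k + (if i = k \<and> i \<in> U then forced_diag m f i else 0)"
  by (simp_all add: insert_diag_def)

text \<open>
At a position of \<open>U\<close> the column sum above and the row sum to the right agree, both being \<open>c\<close>,
and adding the diagonal entry \<open>1 - 2c\<close> changes each to \<open>1 - c\<close>.
\<close>

lemma insert_diag_in_half_asm: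
  assumes f: "f \<in> half_asm m" and U: "U \<subseteq> diag_support m f"
  shows "insert_diag m f U \<in> half_asm (Suc m)"
  unfolding half_asm_def mem_Collect_eq
proof (intro conjI allI impI)
  fix i j k
  show "insert_diag m f U i j = 0" if "\<not> (i < j \<and> j < Suc m)"
    using that half_asmD(1)[OF f] U by (cases j) (auto simp: diag_support_def)
  show "(\<Sum>i<k. insert_diag m f U i j) \<in> {0, 1}"
  proof (cases j)
    case (Suc l)
    have "(\<Sum>i<k. insert_diag m f U i j) =
        (\<Sum>i<k. f i l) + (if l < k \<and> l \<in> U then forced_diag m f l else 0)"
    proof -
      have "(\<Sum>i<k. if i = l \<and> i \<in> U then forced_diag m f i else 0) =
          (\<Sum>i<k. if i = l then (if l \<in> U then forced_diag m f l else 0) else 0)"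
        by (intro sum.cong) auto
      then show ?thesis unfolding Suc by (simp add: sum.distrib)
    qed
    also have "\<dots> \<in> {0, 1}"
    proof (cases "l < k \<and> l \<in> U")
      case True
      then have "forced_diag m f l \<noteq> 0" using U by (auto simp: diag_support_def)
      then show ?thesis
        using True half_asm_column_total[OF f, of l k]
        by (cases rule: forced_diag_cases[OF f, of l]) auto
    next
      case False
      then show ?thesis using half_asmD(2)[OF f, of l k] by auto
    qed
    finally show ?thesis .
  qed simp
  show "(\<Sum>j=k..<Suc m. insert_diag m f U i j) \<in> {0, 1}"
  proof -
    have "(\<Sum>j=k..<Suc m. insert_diag m f U i j) = (\<Sum>j=Suc (k - 1)..<Suc m. insert_diag m f U i j)"
      by (intro sum.mono_neutral_right) (auto simp: not_le less_Suc_eq_0_disj)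
    also have "\<dots> = (\<Sum>j=k-1..<m. insert_diag m f U i (Suc j))"
      by (rule sum.shift_bounds_Suc_ivl)
    also have "\<dots> = (\<Sum>j=k-1..<m. f i j) +
        (if k - 1 \<le> i \<and> i < m \<and> i \<in> U then forced_diag m f i else 0)"
    proof -
      have "(\<Sum>j=k-1..<m. if i = j \<and> i \<in> U then forced_diag m f i else 0) =
          (\<Sum>j=k-1..<m. if i = j then (if i \<in> U then forced_diag m f i else 0) else 0)"
        by (intro sum.cong) auto
      then show ?thesis by (simp add: sum.distrib)
    qed
    also have "\<dots> \<in> {0, 1}"
    proof (cases "k - 1 \<le> i \<and> i < m \<and> i \<in> U")
      case True
      then have "forced_diag m f i \<noteq> 0" using U by (auto simp: diag_support_def)
      then show ?thesis
        using True half_asm_row_total[OF f, of "k - 1" i]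
        by (cases rule: forced_diag_cases[OF f, of i]) auto
    next
      case False
      then show ?thesis using half_asmD(3)[OF f, of i "k - 1"] by auto
    qed
    finally show ?thesis .
  qed
qed

lemma delete_diag_column:
  "(\<Sum>i<k. delete_diag g i j) = (\<Sum>i<min k j. g i (Suc j))"
proof -
  have "(\<Sum>i<k. delete_diag g i j) = (\<Sum>i<min k j. delete_diag g i j)"
    by (intro sum.mono_neutral_right) (auto simp: delete_diag_def)
  then show ?thesis by (simp add: delete_diag_def)
qed

lemma delete_diag_row:
  "(\<Sum>j=k..<m. delete_diag g i j) = (\<Sum>j=Suc (max k (Suc i))..<Suc m. g i j)"
proof -
  have "(\<Sum>j=k..<m. delete_diag g i j) = (\<Sum>j=max k (Suc i)..<m. delete_diag g i j)"
    by (intro sum.mono_neutral_right) (auto simp: delete_diag_def)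
  also have "\<dots> = (\<Sum>j=max k (Suc i)..<m. g i (Suc j))"
    by (intro sum.cong) (auto simp: delete_diag_def)
  finally show ?thesis unfolding sum.shift_bounds_Suc_ivl .
qed

lemma delete_diag_in_half_asm:
  assumes g: "g \<in> half_asm (Suc m)"
  shows "delete_diag g \<in> half_asm m"
  unfolding half_asm_def mem_Collect_eq delete_diag_column delete_diag_row
  using half_asmD[OF g] by (auto simp: delete_diag_def)

text \<open>
A nonzero superdiagonal entry \<open>a\<close> can be added to both neighbouring partial sums \<open>c\<close> and \<open>d\<close>
without leaving \<open>{0, 1}\<close>. This forces \<open>c = d\<close> and \<open>a = 1 - 2c = 1 - c - d\<close>.
\<close>

lemma forced_diag_delete_diag:
  assumes g: "g \<in> half_asm (Suc m)" and nz: "g i (Suc i) \<noteq> 0"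
  shows "forced_diag m (delete_diag g) i = g i (Suc i)"
proof -
  have i: "Suc i < Suc m" using half_asmD(1)[OF g, of i "Suc i"] nz by auto
  have "(\<Sum>k<i. g k (Suc i)) \<in> {0, 1}" "(\<Sum>k<i. g k (Suc i)) + g i (Suc i) \<in> {0, 1}"
    using half_asmD(2)[OF g, of "Suc i" i] half_asmD(2)[OF g, of "Suc i" "Suc i"] by auto
  moreover have "(\<Sum>j=Suc (Suc i)..<Suc m. g i j) \<in> {0, 1}"
      "g i (Suc i) + (\<Sum>j=Suc (Suc i)..<Suc m. g i j) \<in> {0, 1}"
    using half_asmD(3)[OF g, of i "Suc (Suc i)"] half_asmD(3)[OF g, of i "Suc i"]
      sum.atLeast_Suc_lessThan[OF i, of "g i"] by auto
  ultimately show ?thesis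
    using nz unfolding forced_diag_def delete_diag_column delete_diag_row by auto
qed

lemma bij_betw_insert_diag:
  "bij_betw (\<lambda>(f, U). insert_diag m f U) (SIGMA f:half_asm m. Pow (diag_support m f))
     (half_asm (Suc m))"
proof (intro bij_betw_byWitness[where f' = "\<lambda>g. (delete_diag g, {i. g i (Suc i) \<noteq> 0})"])
  show "\<forall>p\<in>(SIGMA f:half_asm m. Pow (diag_support m f)).
      (delete_diag ((\<lambda>(f, U). insert_diag m f U) p),
       {i. (\<lambda>(f, U). insert_diag m f U) p i (Suc i) \<noteq> 0}) = p"
  proof -
    have "(delete_diag (insert_diag m f U), {i. insert_diag m f U i (Suc i) \<noteq> 0}) = (f, U)"
      if f: "f \<in> half_asm m" and U: "U \<subseteq> diag_support m f" for f U
    proof -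
      have "delete_diag (insert_diag m f U) = f"
        using half_asmD(1)[OF f] by (intro ext) (auto simp: delete_diag_def)
      moreover have "{i. insert_diag m f U i (Suc i) \<noteq> 0} = U"
        using half_asmD(1)[OF f] U by (auto simp: diag_support_def split: if_splits)
      ultimately show ?thesis by simp
    qed
    then show ?thesis by auto
  qed
  show "\<forall>g\<in>half_asm (Suc m). (\<lambda>(f, U). insert_diag m f U)
      (delete_diag g, {i. g i (Suc i) \<noteq> 0}) = g"
  proof
    fix g assume g: "g \<in> half_asm (Suc m)"
    have "insert_diag m (delete_diag g) {i. g i (Suc i) \<noteq> 0} i j = g i j" for i j
    proof (cases j)
      case (Suc k)
      then show ?thesis
        using half_asmD(1)[OF g, of i "Suc k"] forced_diag_delete_diag[OF g, of i]
        by (cases i k rule: linorder_cases) (auto simp: delete_diag_def)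
    qed (use half_asmD(1)[OF g] in simp)
    then show "(\<lambda>(f, U). insert_diag m f U) (delete_diag g, {i. g i (Suc i) \<noteq> 0}) = g"
      by auto
  qed
  show "(\<lambda>(f, U). insert_diag m f U) ` (SIGMA f:half_asm m. Pow (diag_support m f))
      \<subseteq> half_asm (Suc m)"
    using insert_diag_in_half_asm by auto
  show "(\<lambda>g. (delete_diag g, {i. g i (Suc i) \<noteq> 0})) ` half_asm (Suc m)
      \<subseteq> (SIGMA f:half_asm m. Pow (diag_support m f))"
  proof -
    have "i \<in> diag_support m (delete_diag g)"
      if g: "g \<in> half_asm (Suc m)" and nz: "g i (Suc i) \<noteq> 0" for g i
      using forced_diag_delete_diag[OF g nz] half_asmD(1)[OF g, of i "Suc i"] nz
      by (auto simp: diag_support_def)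
    then show ?thesis using delete_diag_in_half_asm by auto
  qed
qed

lemma finite_half_asm: "finite (half_asm n)"
proof (induction n)
  case 0
  have "half_asm 0 \<subseteq> {\<lambda>_ _. 0}" by (auto simp: half_asm_def)
  then show ?case by (rule finite_subset) simp
next
  case (Suc m)
  then have "finite (SIGMA f:half_asm m. Pow (diag_support m f))" by simp
  then show ?case using bij_betw_finite[OF bij_betw_insert_diag] by blast
qed

lemma sum_half_asm_Suc:
  "(\<Sum>g\<in>half_asm (Suc m). h g) =
    (\<Sum>f\<in>half_asm m. \<Sum>U\<in>Pow (diag_support m f). h (insert_diag m f U))"
proof -
  have "(\<Sum>g\<in>half_asm (Suc m). h g) =
      (\<Sum>(f, U)\<in>(SIGMA f:half_asm m. Pow (diag_support m f)). h (insert_diag m f U))"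
    by (subst sum.reindex_bij_betw[OF bij_betw_insert_diag, symmetric])
      (auto intro: sum.cong)
  also have "\<dots> = (\<Sum>f\<in>half_asm m. \<Sum>U\<in>Pow (diag_support m f). h (insert_diag m f U))"
    by (rule sum.Sigma[symmetric]) (auto simp: finite_half_asm)
  finally show ?thesis .
qed

lemma half_weight_insert_diag:
  assumes f: "f \<in> half_asm m" and U: "U \<subseteq> diag_support m f"
  shows "half_weight (Suc m) (insert_diag m f U) = half_weight m f + card U"
proof -
  have diag: "\<bar>insert_diag m f U k (Suc k)\<bar> = (if k \<in> U then 1 else 0)" for k
    using half_asmD(1)[OF f, of k k] U
    by (cases rule: forced_diag_cases[OF f, of k]) (auto simp: diag_support_def)
  have "U \<subseteq> {..<m}" using U by (auto simp: diag_support_def)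
  then have card: "(\<Sum>k<m. if k \<in> U then 1 else 0) = int (card U)"
    by (simp add: sum.If_cases Int_absorb1)
  have "(\<Sum>j<Suc m. \<Sum>i<j. \<bar>insert_diag m f U i j\<bar>) =
      (\<Sum>k<m. (\<Sum>i<k. \<bar>insert_diag m f U i (Suc k)\<bar>) + (if k \<in> U then 1 else 0))"
    by (subst sum.lessThan_Suc_shift) (simp add: diag del: insert_diag_simps)
  also have "\<dots> = (\<Sum>k<m. (\<Sum>i<k. \<bar>f i k\<bar>) + (if k \<in> U then 1 else 0))"
    by (intro sum.cong refl arg_cong2[where f = "(+)"]) auto
  also have "\<dots> = (\<Sum>k<m. \<Sum>i<k. \<bar>f i k\<bar>) + int (card U)"
    by (simp only: sum.distrib card)
  finally show ?thesis
    by (simp add: half_weight_def nat_add_distrib sum_nonneg)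
qed

section \<open>Summing over the choices on the superdiagonal\<close>

lemma sum_Pow_insert:
  assumes "finite A" "x \<notin> A"
  shows "(\<Sum>U\<in>Pow (insert x A). h U) = (\<Sum>U\<in>Pow A. h U) + (\<Sum>U\<in>Pow A. h (insert x U))"
proof -
  have "inj_on (insert x) (Pow A)" using assms(2) by (auto simp: inj_on_def)
  moreover have "Pow A \<inter> insert x ` Pow A = {}" using assms(2) by auto
  ultimately show ?thesis
    using assms(1) by (simp add: Pow_insert sum.union_disjoint sum.reindex)
qed

lemma sum_Pow_power_card:
  fixes r :: "'a::comm_semiring_1"
  assumes "finite A"
  shows "(\<Sum>U\<in>Pow A. r ^ card U) = (r + 1) ^ card A"
  using assms
proof (induction A rule: finite_induct)
  case (insert x A)
  have "(\<Sum>U\<in>Pow A. r ^ card (insert x U)) = (\<Sum>U\<in>Pow A. r * r ^ card U)"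
  proof (intro sum.cong refl)
    fix U assume "U \<in> Pow A"
    then have "finite U" "x \<notin> U" using insert.hyps finite_subset by auto
    then show "r ^ card (insert x U) = r * r ^ card U" by simp
  qed
  then show ?case
    using insert by (simp add: sum_Pow_insert sum_distrib_left[symmetric] algebra_simps)
qed simp

lemma sum_DSASM_half_asm:
  "(\<Sum>A\<in>DSASM n. h (R_stat A) (S_stat A) (T_stat A)) =
    (\<Sum>f\<in>half_asm n. h (half_weight n f) (card (diag_support n f)) (T_stat (sym_mat n f)))"
  by (subst sum.reindex_bij_betw[OF bij_betw_sym_mat, symmetric])
    (simp add: R_stat_sym_mat S_stat_sym_mat)

text \<open>
The case \<open>t = 1\<close> of the recurrence. It includes \<open>m = 0\<close>, and over the semiring of natural numbers
it specialises to the cardinality formula.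
\<close>

lemma DSASM_Suc_sum:
  fixes r :: "'a::comm_semiring_1"
  shows "(\<Sum>A\<in>DSASM (Suc m). r ^ R_stat A) = (\<Sum>A\<in>DSASM m. r ^ R_stat A * (r + 1) ^ S_stat A)"
proof -
  have "(\<Sum>A\<in>DSASM (Suc m). r ^ R_stat A) =
      (\<Sum>f\<in>half_asm m. \<Sum>U\<in>Pow (diag_support m f). r ^ half_weight m f * r ^ card U)"
    unfolding sum_DSASM_half_asm[where h = "\<lambda>a b c. r ^ a"] sum_half_asm_Suc
    by (intro sum.cong refl) (simp add: half_weight_insert_diag power_add)
  also have "\<dots> = (\<Sum>A\<in>DSASM m. r ^ R_stat A * (r + 1) ^ S_stat A)"
    unfolding sum_DSASM_half_asm[where h = "\<lambda>a b c. r ^ a * (r + 1) ^ b"]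
    by (simp add: sum_distrib_left[symmetric] sum_Pow_power_card)
  finally show ?thesis .
qed

section \<open>The first row\<close>

lemma sym_mat_first_row:
  assumes f: "f \<in> half_asm n" and "j < n"
  shows "sym_mat n f $$ (0, j) = (if j = 0 then forced_diag n f 0 else f 0 j)"
  using half_asmD(1)[OF f] assms(2) by (auto simp: sym_mat_def)

lemma forced_diag_0:
  assumes f: "f \<in> half_asm n"
  shows "forced_diag n f 0 = 1 - (\<Sum>j<n. f 0 j)"
  using half_asm_row_total[OF f, of 0 0] by (simp add: forced_diag_def lessThan_atLeast0)

text \<open>
The leading \<open>1\<close> is at the corner exactly when the diagonal entry there is nonzero, since the
column sum above the corner is empty. If it lies to the right of the corner, the shift
moves it by one column. If it is at the corner, then the shifted matrix has its \<open>1\<close> at the new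
superdiagonal position \<open>(0, 1)\<close> when \<open>0 \<in> U\<close>; otherwise its first row vanishes off the corner,
and the corner is forced to be \<open>1\<close> again.
\<close>

lemma T_stat_insert_diag:
  assumes f: "f \<in> half_asm m" and m: "m > 0" and U: "U \<subseteq> diag_support m f"
  shows "0 \<notin> diag_support m f \<Longrightarrow>
      T_stat (sym_mat (Suc m) (insert_diag m f U)) = Suc (T_stat (sym_mat m f))"
    and "0 \<in> diag_support m f \<Longrightarrow> T_stat (sym_mat m f) = 1"
    and "0 \<in> diag_support m f \<Longrightarrow>
      T_stat (sym_mat (Suc m) (insert_diag m f U)) = (if 0 \<in> U then 2 else 1)"
proof -
  let ?g = "insert_diag m f U"
  have g: "?g \<in> half_asm (Suc m)" using insert_diag_in_half_asm[OF f U] .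
  note Tf = T_stat_eqI[OF sym_mat_in_DSASM[OF f]] and Tg = T_stat_eqI[OF sym_mat_in_DSASM[OF g]]
  note rf = sym_mat_first_row[OF f] and rg = sym_mat_first_row[OF g]
  {
    assume "0 \<notin> diag_support m f"
    then have z: "forced_diag m f 0 = 0" using m by (simp add: diag_support_def)
    obtain j where j: "j < m" "sym_mat m f $$ (0, j) = 1"
      using DSASM_first_row[OF sym_mat_in_DSASM[OF f] m] by auto
    then have "j \<noteq> 0" "f 0 j = 1" using rf[of j] z by (auto split: if_splits)
    then have "sym_mat (Suc m) ?g $$ (0, Suc j) = 1" using rg[of "Suc j"] j by simp
    then show "T_stat (sym_mat (Suc m) ?g) = Suc (T_stat (sym_mat m f))"
      using Tf[OF j] Tg[of "Suc j"] j by simp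
  }
  assume nz: "0 \<in> diag_support m f"
  then have one: "forced_diag m f 0 = 1"
    by (cases rule: forced_diag_cases[OF f, of 0]) (auto simp: diag_support_def)
  then show "T_stat (sym_mat m f) = 1" using Tf[of 0] rf[of 0] m by simp
  show "T_stat (sym_mat (Suc m) ?g) = (if 0 \<in> U then 2 else 1)"
  proof (cases "0 \<in> U")
    case True
    then have "?g 0 1 = 1" using one half_asmD(1)[OF f, of 0 0] by simp
    then show ?thesis using True Tg[of 1] rg[of 1] m by simp
  next
    case False
    then have "(\<Sum>j<Suc m. ?g 0 j) = (\<Sum>j<m. f 0 j)"
      unfolding sum.lessThan_Suc_shift by (auto intro: sum.cong)
    then have "forced_diag (Suc m) ?g 0 = 1"
      using one forced_diag_0[OF f] forced_diag_0[OF g] by simp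
    then show ?thesis using False Tg[of 0] rg[of 0] by simp
  qed
qed

text \<open>
If the corner is a nonzero diagonal position, the sum over the subsets of the remaining positions
factors out, and the two choices at the corner contribute
\<open>t + r t\<^sup>2 = t ((r + 1) t) + t (1 - t)\<close>.
\<close>

lemma superdiagonal_sum:
  fixes r t :: "'a::comm_ring_1"
  assumes f: "f \<in> half_asm m" and m: "m > 0"
  defines "N \<equiv> diag_support m f"
  shows "(\<Sum>U\<in>Pow N. r ^ card U * t ^ T_stat (sym_mat (Suc m) (insert_diag m f U))) =
    t * ((r + 1) ^ card N * t ^ T_stat (sym_mat m f)) +
    t * (1 - t) * (if 0 \<in> N then (r + 1) ^ card (N - {0}) else 0)"
proof (cases "0 \<in> N")
  case False
  have "(\<Sum>U\<in>Pow N. r ^ card U * t ^ T_stat (sym_mat (Suc m) (insert_diag m f U))) =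
      (\<Sum>U\<in>Pow N. r ^ card U * t ^ Suc (T_stat (sym_mat m f)))"
    using T_stat_insert_diag(1)[OF f m] False by (intro sum.cong) (auto simp: N_def)
  also have "\<dots> = (r + 1) ^ card N * t ^ Suc (T_stat (sym_mat m f))"
    by (simp only: sum_distrib_right[symmetric]) (simp add: N_def sum_Pow_power_card)
  finally show ?thesis using False by (simp add: algebra_simps)
next
  case True
  let ?N = "N - {0}"
  have fin: "finite ?N" by (simp add: N_def)
  have N: "N = insert 0 ?N" using True by auto
  have card: "card N = Suc (card ?N)" using True by (intro card.remove) (auto simp: N_def)
  have T: "T_stat (sym_mat (Suc m) (insert_diag m f U)) = (if 0 \<in> U then 2 else 1)"
    if "U \<subseteq> N" for U
    using T_stat_insert_diag(3)[OF f m] that True by (simp add: N_def)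
  have "(\<Sum>U\<in>Pow N. r ^ card U * t ^ T_stat (sym_mat (Suc m) (insert_diag m f U))) =
      (\<Sum>U\<in>Pow N. r ^ card U * t ^ (if 0 \<in> U then 2 else 1))"
    using T by (intro sum.cong) auto
  also have "\<dots> = (\<Sum>U\<in>Pow (insert 0 ?N). r ^ card U * t ^ (if 0 \<in> U then 2 else 1))"
    using N by simp
  also have "\<dots> = (\<Sum>U\<in>Pow ?N. r ^ card U * t ^ (if 0 \<in> U then 2 else 1)) +
      (\<Sum>U\<in>Pow ?N. r ^ card (insert 0 U) * t ^ (if 0 \<in> insert 0 U then 2 else 1))"
    using fin by (intro sum_Pow_insert) auto
  also have "(\<Sum>U\<in>Pow ?N. r ^ card U * t ^ (if 0 \<in> U then 2 else 1)) = (\<Sum>U\<in>Pow ?N. r ^ card U * t)"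
    by (intro sum.cong) auto
  also have "(\<Sum>U\<in>Pow ?N. r ^ card (insert 0 U) * t ^ (if 0 \<in> insert 0 U then 2 else 1)) =
      (\<Sum>U\<in>Pow ?N. r ^ card U * (r * t ^ 2))"
  proof (intro sum.cong refl)
    fix U assume "U \<in> Pow ?N"
    then have "finite U" "0 \<notin> U" using fin finite_subset by auto
    then show "r ^ card (insert 0 U) * t ^ (if 0 \<in> insert 0 U then 2 else 1) =
        r ^ card U * (r * t ^ 2)" by (simp add: algebra_simps)
  qed
  also have "(\<Sum>U\<in>Pow ?N. r ^ card U * t) + (\<Sum>U\<in>Pow ?N. r ^ card U * (r * t ^ 2)) =
      (r + 1) ^ card ?N * (t + r * t ^ 2)"
    by (simp only: sum_distrib_right[symmetric] sum_Pow_power_card[OF fin]) (simp add: algebra_simps)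
  also have "\<dots> = t * ((r + 1) ^ card N * t ^ 1) + t * (1 - t) * (r + 1) ^ card ?N"
  proof -
    have "p * (t + r * t ^ 2) = t * ((r + 1) * p * t ^ 1) + t * (1 - t) * p" for p
      by (simp add: algebra_simps power2_eq_square)
    then show ?thesis by (simp only: card power_Suc)
  qed
  finally show ?thesis
    using True T_stat_insert_diag(2)[OF f m, of "{}"] by (simp only: N_def if_True empty_subsetI)
qed

section \<open>Deleting the first row\<close>

text \<open>
On matrices this is \<open>B \<mapsto> 1 \<oplus> B\<close>, a new corner \<open>1\<close> with zeros in the rest of its row and column;
the corner itself is not part of the triangle.
\<close>

definition prepend_row :: "(nat \<Rightarrow> nat \<Rightarrow> int) \<Rightarrow> nat \<Rightarrow> nat \<Rightarrow> int" where
  "prepend_row f i j = (if i = 0 \<or> j = 0 then 0 else f (i - 1) (j - 1))"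

lemma prepend_row_simps [simp]:
  "prepend_row f 0 j = 0" "prepend_row f i 0 = 0" "prepend_row f (Suc i) (Suc j) = f i j"
  by (auto simp: prepend_row_def)

lemma prepend_row_column: "(\<Sum>i<Suc k. prepend_row f i (Suc j)) = (\<Sum>i<k. f i j)"
  unfolding sum.lessThan_Suc_shift by simp

lemma prepend_row_row: "(\<Sum>j=Suc k..<Suc n. prepend_row f (Suc i) j) = (\<Sum>j=k..<n. f i j)"
  unfolding sum.shift_bounds_Suc_ivl by simp

lemma forced_diag_prepend_row:
  "forced_diag (Suc n) (prepend_row f) 0 = 1"
  "forced_diag (Suc n) (prepend_row f) (Suc i) = forced_diag n f i"
  unfolding forced_diag_def prepend_row_column prepend_row_row by auto

lemma prepend_row_in_half_asm:
  assumes f: "f \<in> half_asm n"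
  shows "prepend_row f \<in> half_asm (Suc n)"
  unfolding half_asm_def mem_Collect_eq
proof (intro conjI allI impI)
  fix i j k
  show "prepend_row f i j = 0" if "\<not> (i < j \<and> j < Suc n)"
    using that half_asmD(1)[OF f] by (cases i; cases j) auto
  show "(\<Sum>i<k. prepend_row f i j) \<in> {0, 1}"
  proof (cases "k = 0 \<or> j = 0")
    case False
    then obtain k' j' where "k = Suc k'" "j = Suc j'" by (metis not0_implies_Suc)
    then show ?thesis using half_asmD(2)[OF f, of j' k'] by (simp only: prepend_row_column)
  qed auto
  show "(\<Sum>j=k..<Suc n. prepend_row f i j) \<in> {0, 1}"
  proof (cases i)
    case (Suc i')
    have "(\<Sum>j=k..<Suc n. prepend_row f i j) = (\<Sum>j=Suc (k - 1)..<Suc n. prepend_row f i j)"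
      by (intro sum.mono_neutral_right) (auto simp: not_le less_Suc_eq_0_disj)
    then show ?thesis unfolding Suc prepend_row_row using half_asmD(3)[OF f, of i' "k - 1"] by simp
  qed simp
qed

text \<open>
A nonzero corner means that the first row of the triangle sums to \<open>0\<close>, and its entries are
nonnegative.
\<close>

lemma half_asm_first_row_zero:
  assumes g: "g \<in> half_asm n" and d: "0 \<in> diag_support n g"
  shows "g 0 j = 0"
proof -
  have "(\<Sum>j<n. g 0 j) = 0"
    using d forced_diag_0[OF g] half_asmD(3)[OF g, of 0 0]
    by (auto simp: diag_support_def lessThan_atLeast0)
  moreover have "0 \<le> g 0 j" for j using half_asmD(2)[OF g, of j 1] by auto
  ultimately have "\<forall>j\<in>{..<n}. g 0 j = 0" by (subst (asm) sum_nonneg_eq_0_iff) auto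
  then show ?thesis using half_asmD(1)[OF g, of 0 j] by auto
qed

lemma bij_betw_prepend_row:
  "bij_betw prepend_row (half_asm m) {g \<in> half_asm (Suc m). 0 \<in> diag_support (Suc m) g}"
proof (intro bij_betw_byWitness[where f' = "\<lambda>g i j. g (Suc i) (Suc j)"] ballI)
  fix g assume "g \<in> {g \<in> half_asm (Suc m). 0 \<in> diag_support (Suc m) g}"
  then have g: "g \<in> half_asm (Suc m)" and d: "0 \<in> diag_support (Suc m) g" by auto
  show "prepend_row (\<lambda>i j. g (Suc i) (Suc j)) = g"
    using half_asm_first_row_zero[OF g d] half_asmD(1)[OF g]
    by (intro ext) (auto simp: prepend_row_def)
next
  show "prepend_row ` half_asm m \<subseteq> {g \<in> half_asm (Suc m). 0 \<in> diag_support (Suc m) g}"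
    using prepend_row_in_half_asm by (auto simp: diag_support_def forced_diag_prepend_row)
next
  have "(\<lambda>i j. g (Suc i) (Suc j)) \<in> half_asm m"
    if g: "g \<in> half_asm (Suc m)" and d: "0 \<in> diag_support (Suc m) g" for g
    unfolding half_asm_def mem_Collect_eq
  proof (intro conjI allI impI)
    fix i j k
    show "g (Suc i) (Suc j) = 0" if "\<not> (i < j \<and> j < m)"
      using that half_asmD(1)[OF g] by simp
    have "(\<Sum>i<k. g (Suc i) (Suc j)) = (\<Sum>i<Suc k. g i (Suc j))"
      unfolding sum.lessThan_Suc_shift by (simp add: half_asm_first_row_zero[OF g d])
    then show "(\<Sum>i<k. g (Suc i) (Suc j)) \<in> {0, 1}"
      using half_asmD(2)[OF g] by metis
    show "(\<Sum>j=k..<m. g (Suc i) (Suc j)) \<in> {0, 1}"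
      using half_asmD(3)[OF g, of "Suc i" "Suc k"] unfolding sum.shift_bounds_Suc_ivl .
  qed
  then show "(\<lambda>g i j. g (Suc i) (Suc j)) ` {g \<in> half_asm (Suc m). 0 \<in> diag_support (Suc m) g}
      \<subseteq> half_asm m" by auto
qed simp

lemma half_weight_prepend_row: "half_weight (Suc m) (prepend_row f) = half_weight m f"
  unfolding half_weight_def sum.lessThan_Suc_shift by simp

lemma card_diag_support_prepend_row:
  "card (diag_support (Suc m) (prepend_row f) - {0}) = card (diag_support m f)"
proof -
  have "i \<in> diag_support (Suc m) (prepend_row f) - {0} \<longleftrightarrow> i \<in> Suc ` diag_support m f" for i
    by (cases i) (auto simp: diag_support_def forced_diag_prepend_row)
  then have "diag_support (Suc m) (prepend_row f) - {0} = Suc ` diag_support m f" by blast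
  then show ?thesis by (simp add: card_image)
qed

text \<open>
This is the correction term of the recurrence: the DSASMs of size \<open>m + 1\<close> with \<open>T = 1\<close>, where the
corner entry is not weighted.
\<close>

lemma sum_leading_one:
  fixes r :: "'a::comm_semiring_1"
  shows "(\<Sum>f\<in>half_asm (Suc m). r ^ half_weight (Suc m) f *
      (if 0 \<in> diag_support (Suc m) f then (r + 1) ^ card (diag_support (Suc m) f - {0}) else 0)) =
    (\<Sum>A\<in>DSASM m. r ^ R_stat A * (r + 1) ^ S_stat A)"
proof -
  have "(\<Sum>f\<in>half_asm (Suc m). r ^ half_weight (Suc m) f *
      (if 0 \<in> diag_support (Suc m) f then (r + 1) ^ card (diag_support (Suc m) f - {0}) else 0)) =
    (\<Sum>f\<in>{g \<in> half_asm (Suc m). 0 \<in> diag_support (Suc m) g}.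
      r ^ half_weight (Suc m) f * (r + 1) ^ card (diag_support (Suc m) f - {0}))"
    by (intro sum.mono_neutral_cong_right) (auto simp: finite_half_asm)
  also have "\<dots> = (\<Sum>f\<in>half_asm m. r ^ half_weight m f * (r + 1) ^ card (diag_support m f))"
    by (subst sum.reindex_bij_betw[OF bij_betw_prepend_row, symmetric])
      (simp add: half_weight_prepend_row card_diag_support_prepend_row)
  finally show ?thesis
    unfolding sum_DSASM_half_asm[where h = "\<lambda>a b c. r ^ a * (r + 1) ^ b"] .
qed

section \<open>The recurrence\<close>

lemma X_gf_Suc_Suc:
  fixes r t :: "'a::comm_ring_1"
  shows "X_gf (Suc (Suc m)) r 1 t =
    t * X_gf (Suc m) r (r + 1) t + t * (1 - t) * X_gf m r (r + 1) 1"
proof -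
  let ?m = "Suc m"
  let ?N = "diag_support ?m" and ?w = "half_weight ?m" and ?T = "\<lambda>f. T_stat (sym_mat ?m f)"
  let ?lead = "\<lambda>f. if 0 \<in> ?N f then (r + 1) ^ card (?N f - {0}) else 0"
  have "X_gf (Suc ?m) r 1 t = (\<Sum>f\<in>half_asm ?m. \<Sum>U\<in>Pow (?N f).
      r ^ ?w f * (r ^ card U * t ^ T_stat (sym_mat (Suc ?m) (insert_diag ?m f U))))"
    unfolding X_gf_def sum_DSASM_half_asm[where h = "\<lambda>a b c. r ^ a * 1 ^ b * t ^ c"] sum_half_asm_Suc[of _ ?m]
    by (intro sum.cong refl) (simp add: half_weight_insert_diag power_add mult.assoc)
  also have "\<dots> = (\<Sum>f\<in>half_asm ?m. r ^ ?w f *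
      (t * ((r + 1) ^ card (?N f) * t ^ ?T f) + t * (1 - t) * ?lead f))"
    by (intro sum.cong refl) (simp only: sum_distrib_left[symmetric] superdiagonal_sum zero_less_Suc)
  also have "\<dots> = (\<Sum>f\<in>half_asm ?m. t * (r ^ ?w f * (r + 1) ^ card (?N f) * t ^ ?T f) +
      t * (1 - t) * (r ^ ?w f * ?lead f))"
    by (intro sum.cong refl) (simp only: distrib_left mult.commute mult.left_commute mult.assoc)
  also have "\<dots> = t * X_gf ?m r (r + 1) t + t * (1 - t) * X_gf m r (r + 1) 1"
    unfolding X_gf_def sum_DSASM_half_asm[of "\<lambda>a b c. r ^ a * (r + 1) ^ b * t ^ c" ?m]
    by (simp only: sum.distrib sum_distrib_left[symmetric] sum_leading_one power_one mult_1_right)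
  finally show ?thesis .
qed

theorem proposition5p1:
  fixes n :: nat and r t :: "'a::comm_ring_1"
  assumes "n \<ge> 2"
  shows "card (DSASM n) = (\<Sum>A\<in>DSASM (n - 1). 2 ^ S_stat A)
    \<and> X_gf n r 1 t = t * X_gf (n - 1) r (r + 1) t + t * (1 - t) * X_gf (n - 1) r 1 1
    \<and> (n \<ge> 3 \<longrightarrow>
         X_gf n r 1 t = t * X_gf (n - 1) r (r + 1) t + t * (1 - t) * X_gf (n - 2) r (r + 1) 1)"
proof -
  obtain m where n: "n = Suc (Suc m)"
    using assms by (metis Suc_le_D numeral_2_eq_2 Suc_le_mono)
  have "card (DSASM n) = (\<Sum>A\<in>DSASM (n - 1). 2 ^ S_stat A)"
    using DSASM_Suc_sum[of "1 :: nat" "Suc m"] by (simp add: n numeral_2_eq_2)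
  moreover have "X_gf (Suc m) r 1 1 = X_gf m r (r + 1) 1"
    using DSASM_Suc_sum[of r m] by (simp add: X_gf_def)
  ultimately show ?thesis
    using X_gf_Suc_Suc[of m r t] by (simp add: n)
qed

end
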